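(* Let $X$ and $Y$ be linear spaces over a field $\mathbb{K}$, let $\beta_{2},\gamma_{1,1},\gamma_{1,2},\gamma_{2,1},\gamma_{2,2}\in \mathbb{K}$ be given constants such that not all of them are zero, where $\beta_{2}\neq 0$, and let $f\colon X\times Y\to \mathbb{K}$ be a function with $f(0,0)=0$ such that \[ f(0,\beta_{2}y_{2})=\gamma_{1,1}f(x_{1},y_{1})+\gamma_{1,2}f(x_{1},y_{2})+\gamma_{2,1}f(x_{2},y_{1})+\gamma_{2,2}f(x_{2},y_{2}) \qquad (x_{1}, x_{2}\in X,\ y_{1}, y_{2}\in Y). \] Then and only then there exist functions $\chi\colon X\to \mathbb{K}$ and $\zeta\colon Y\to \mathbb{K}$ vanishing at zero such that \[ f(x,z)=\chi(x)+\zeta(z) \qquad (x\in X,\ z\in Y). \] Furthermore, (i) either the system of linear equations $\gamma_{1,1}+\gamma_{1,2}=0$, $\gamma_{2,1}+\gamma_{2,2}=0$ is fulfilled, or the function $\chi$ is identically zero; (ii) either the system of equations $\gamma_{1,1}+\gamma_{2,1}=0$, $\zeta(\beta_{2}z)=(\gamma_{1,2}+\gamma_{2,2})\zeta(z)$ $(z\in Y)$ is fulfilled, or the function $\zeta$ is identically zero.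
   Context: "Then and only then" means that the functional equation holds if and only if $f$ has the stated form together with the conditions (i) and (ii).
   Formalization: "Not all of them are zero" is taken to mean that the four constants γ are not all zero; if all γ vanish the claim fails, e.g. for β₂ = 1, X = Y = K and f(x,y) = xy. *)

theory Defs
  imports Complex_Main
begin

end

theory Submission
  imports Defs
begin

text \<open>
  The two summands can only be the traces \<open>\<chi> x = f (x, 0)\<close> and \<open>\<zeta> z = f (0, z)\<close> of \<open>f\<close> on the axes.
  Let \<open>D (x, z) = f (x, z) - f (x, 0) - f (0, z)\<close> measure the failure of the decomposition. Putting
  zeros for one \<open>x\<close>-variable and one \<open>y\<close>-variable in the functional equation leaves an equation
  in which exactly one of the four coefficients \<open>\<gamma>\<close> multiplies \<open>f (x, z)\<close> off the axes; the other
  values lie on the axes. Specialising further to the axes gives linear relations that cancel those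
  other values, so what remains is \<open>\<gamma> * D (x, z) = 0\<close>. As this holds for each of the four coefficients
  and one of them is nonzero, \<open>D\<close> vanishes. The relations on the axes are the alternatives (i) and (ii).

  For a decomposed \<open>f\<close>, the right-hand side of the equation is
  \<open>(\<gamma>\<^sub>1\<^sub>1 + \<gamma>\<^sub>1\<^sub>2) * \<chi> x\<^sub>1 + (\<gamma>\<^sub>2\<^sub>1 + \<gamma>\<^sub>2\<^sub>2) * \<chi> x\<^sub>2 + (\<gamma>\<^sub>1\<^sub>1 + \<gamma>\<^sub>2\<^sub>1) * \<zeta> y\<^sub>1 + (\<gamma>\<^sub>1\<^sub>2 + \<gamma>\<^sub>2\<^sub>2) * \<zeta> y\<^sub>2\<close>,
  and (i) and (ii) reduce it to \<open>\<zeta> (\<beta>\<^sub>2 y\<^sub>2)\<close>.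
\<close>

theorem proposition11:
  fixes scaleX :: "'k::field \<Rightarrow> 'x::ab_group_add \<Rightarrow> 'x"
    and scaleY :: "'k \<Rightarrow> 'y::ab_group_add \<Rightarrow> 'y"
    and \<beta>\<^sub>2 \<gamma>\<^sub>1\<^sub>1 \<gamma>\<^sub>1\<^sub>2 \<gamma>\<^sub>2\<^sub>1 \<gamma>\<^sub>2\<^sub>2 :: 'k
    and f :: "'x \<times> 'y \<Rightarrow> 'k"
  assumes X: "vector_space scaleX"
    and Y: "vector_space scaleY"
    and gamma_nonzero: "\<not> (\<gamma>\<^sub>1\<^sub>1 = 0 \<and> \<gamma>\<^sub>1\<^sub>2 = 0 \<and> \<gamma>\<^sub>2\<^sub>1 = 0 \<and> \<gamma>\<^sub>2\<^sub>2 = 0)"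
    and beta_nonzero: "\<beta>\<^sub>2 \<noteq> 0"
    and f_zero: "f (0, 0) = 0"
  shows "(\<forall>x\<^sub>1 x\<^sub>2 y\<^sub>1 y\<^sub>2. f (0, scaleY \<beta>\<^sub>2 y\<^sub>2) =
             \<gamma>\<^sub>1\<^sub>1 * f (x\<^sub>1, y\<^sub>1) + \<gamma>\<^sub>1\<^sub>2 * f (x\<^sub>1, y\<^sub>2) + \<gamma>\<^sub>2\<^sub>1 * f (x\<^sub>2, y\<^sub>1) + \<gamma>\<^sub>2\<^sub>2 * f (x\<^sub>2, y\<^sub>2))
         \<longleftrightarrow>
         (\<exists>(\<chi> :: 'x \<Rightarrow> 'k) (\<zeta> :: 'y \<Rightarrow> 'k).
             \<chi> 0 = 0 \<and> \<zeta> 0 = 0 \<and>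
             (\<forall>x z. f (x, z) = \<chi> x + \<zeta> z) \<and>
             ((\<gamma>\<^sub>1\<^sub>1 + \<gamma>\<^sub>1\<^sub>2 = 0 \<and> \<gamma>\<^sub>2\<^sub>1 + \<gamma>\<^sub>2\<^sub>2 = 0) \<or> (\<forall>x. \<chi> x = 0)) \<and>
             ((\<gamma>\<^sub>1\<^sub>1 + \<gamma>\<^sub>2\<^sub>1 = 0 \<and> (\<forall>z. \<zeta> (scaleY \<beta>\<^sub>2 z) = (\<gamma>\<^sub>1\<^sub>2 + \<gamma>\<^sub>2\<^sub>2) * \<zeta> z)) \<or> (\<forall>z. \<zeta> z = 0)))"
proof -
  interpret Y: vector_space scaleY by (rule Y)
  show ?thesis (is "?eqn \<longleftrightarrow> ?decomp")
  proof
    assume ?eqn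
    then have eqn: "f (0, scaleY \<beta>\<^sub>2 y\<^sub>2) =
        \<gamma>\<^sub>1\<^sub>1 * f (x\<^sub>1, y\<^sub>1) + \<gamma>\<^sub>1\<^sub>2 * f (x\<^sub>1, y\<^sub>2) + \<gamma>\<^sub>2\<^sub>1 * f (x\<^sub>2, y\<^sub>1) + \<gamma>\<^sub>2\<^sub>2 * f (x\<^sub>2, y\<^sub>2)"
      for x\<^sub>1 x\<^sub>2 y\<^sub>1 y\<^sub>2
      by blast
    have e11: "\<gamma>\<^sub>1\<^sub>1 * f (x, z) + \<gamma>\<^sub>1\<^sub>2 * f (x, 0) + \<gamma>\<^sub>2\<^sub>1 * f (0, z) = 0" for x z
      using eqn[of 0 x z 0] by (simp add: f_zero)
    have e21: "\<gamma>\<^sub>1\<^sub>1 * f (0, z) + \<gamma>\<^sub>2\<^sub>1 * f (x, z) + \<gamma>\<^sub>2\<^sub>2 * f (x, 0) = 0" for x z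
      using eqn[of 0 0 z x] by (simp add: f_zero)
    have e12: "f (0, scaleY \<beta>\<^sub>2 z) = \<gamma>\<^sub>1\<^sub>1 * f (x, 0) + \<gamma>\<^sub>1\<^sub>2 * f (x, z) + \<gamma>\<^sub>2\<^sub>2 * f (0, z)" for x z
      using eqn[of z x 0 0] by (simp add: f_zero)
    have e22: "f (0, scaleY \<beta>\<^sub>2 z) = \<gamma>\<^sub>1\<^sub>2 * f (0, z) + \<gamma>\<^sub>2\<^sub>1 * f (x, 0) + \<gamma>\<^sub>2\<^sub>2 * f (x, z)" for x z
      using eqn[of z 0 0 x] by (simp add: f_zero)
    have \<chi>1: "(\<gamma>\<^sub>1\<^sub>1 + \<gamma>\<^sub>1\<^sub>2) * f (x, 0) = 0" for x
      using e11[of x 0] by (simp add: f_zero algebra_simps)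
    have \<chi>2: "(\<gamma>\<^sub>2\<^sub>1 + \<gamma>\<^sub>2\<^sub>2) * f (x, 0) = 0" for x
      using e21[of 0 x] by (simp add: f_zero algebra_simps)
    have \<zeta>1: "(\<gamma>\<^sub>1\<^sub>1 + \<gamma>\<^sub>2\<^sub>1) * f (0, z) = 0" for z
      using e11[of 0 z] by (simp add: f_zero algebra_simps)
    have \<zeta>2: "f (0, scaleY \<beta>\<^sub>2 z) = (\<gamma>\<^sub>1\<^sub>2 + \<gamma>\<^sub>2\<^sub>2) * f (0, z)" for z
      using e12[of z 0] by (simp add: f_zero algebra_simps)
    have sep: "f (x, z) = f (x, 0) + f (0, z)" for x z
    proof -
      define D where "D = f (x, z) - f (x, 0) - f (0, z)"
      have "\<gamma>\<^sub>1\<^sub>1 * D = 0"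
        unfolding D_def using e11[of x z] \<chi>1[of x] \<zeta>1[of z] by algebra
      moreover have "\<gamma>\<^sub>1\<^sub>2 * D = 0"
        unfolding D_def using e12[of z x] \<chi>1[of x] \<zeta>2[of z] by algebra
      moreover have "\<gamma>\<^sub>2\<^sub>1 * D = 0"
        unfolding D_def using e21[of z x] \<chi>2[of x] \<zeta>1[of z] by algebra
      moreover have "\<gamma>\<^sub>2\<^sub>2 * D = 0"
        unfolding D_def using e22[of z x] \<chi>2[of x] \<zeta>2[of z] by algebra
      ultimately have "D = 0"
        using gamma_nonzero by auto
      then show ?thesis
        by (simp add: D_def algebra_simps)
    qed
    show ?decomp
    proof (intro exI conjI)
      show "\<forall>x z. f (x, z) = f (x, 0) + f (0, z)"
        using sep by blast
      show "(\<gamma>\<^sub>1\<^sub>1 + \<gamma>\<^sub>1\<^sub>2 = 0 \<and> \<gamma>\<^sub>2\<^sub>1 + \<gamma>\<^sub>2\<^sub>2 = 0) \<or> (\<forall>x. f (x, 0) = 0)"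
        using \<chi>1 \<chi>2 by (meson mult_eq_0_iff)
      show "(\<gamma>\<^sub>1\<^sub>1 + \<gamma>\<^sub>2\<^sub>1 = 0 \<and> (\<forall>z. f (0, scaleY \<beta>\<^sub>2 z) = (\<gamma>\<^sub>1\<^sub>2 + \<gamma>\<^sub>2\<^sub>2) * f (0, z)))
          \<or> (\<forall>z. f (0, z) = 0)"
        using \<zeta>1 \<zeta>2 by (meson mult_eq_0_iff)
    qed (simp_all add: f_zero)
  next
    assume ?decomp
    then obtain \<chi> \<zeta> where zero: "\<chi> 0 = 0"
      and f: "\<And>x z. f (x, z) = \<chi> x + \<zeta> z"
      and i: "(\<gamma>\<^sub>1\<^sub>1 + \<gamma>\<^sub>1\<^sub>2 = 0 \<and> \<gamma>\<^sub>2\<^sub>1 + \<gamma>\<^sub>2\<^sub>2 = 0) \<or> (\<forall>x. \<chi> x = 0)"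
      and ii: "(\<gamma>\<^sub>1\<^sub>1 + \<gamma>\<^sub>2\<^sub>1 = 0 \<and> (\<forall>z. \<zeta> (scaleY \<beta>\<^sub>2 z) = (\<gamma>\<^sub>1\<^sub>2 + \<gamma>\<^sub>2\<^sub>2) * \<zeta> z))
        \<or> (\<forall>z. \<zeta> z = 0)"
      by blast
    have \<chi>: "(\<gamma>\<^sub>1\<^sub>1 + \<gamma>\<^sub>1\<^sub>2) * \<chi> x = 0" "(\<gamma>\<^sub>2\<^sub>1 + \<gamma>\<^sub>2\<^sub>2) * \<chi> x = 0" for x
      using i by auto
    have \<zeta>: "(\<gamma>\<^sub>1\<^sub>1 + \<gamma>\<^sub>2\<^sub>1) * \<zeta> z = 0" "\<zeta> (scaleY \<beta>\<^sub>2 z) = (\<gamma>\<^sub>1\<^sub>2 + \<gamma>\<^sub>2\<^sub>2) * \<zeta> z" for z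
      using ii by auto
    show ?eqn
    proof (intro allI)
      fix x\<^sub>1 x\<^sub>2 y\<^sub>1 y\<^sub>2
      have "\<gamma>\<^sub>1\<^sub>1 * f (x\<^sub>1, y\<^sub>1) + \<gamma>\<^sub>1\<^sub>2 * f (x\<^sub>1, y\<^sub>2) + \<gamma>\<^sub>2\<^sub>1 * f (x\<^sub>2, y\<^sub>1) + \<gamma>\<^sub>2\<^sub>2 * f (x\<^sub>2, y\<^sub>2)
        = (\<gamma>\<^sub>1\<^sub>1 + \<gamma>\<^sub>1\<^sub>2) * \<chi> x\<^sub>1 + (\<gamma>\<^sub>2\<^sub>1 + \<gamma>\<^sub>2\<^sub>2) * \<chi> x\<^sub>2
          + (\<gamma>\<^sub>1\<^sub>1 + \<gamma>\<^sub>2\<^sub>1) * \<zeta> y\<^sub>1 + (\<gamma>\<^sub>1\<^sub>2 + \<gamma>\<^sub>2\<^sub>2) * \<zeta> y\<^sub>2"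
        by (simp add: f algebra_simps)
      also have "\<dots> = f (0, scaleY \<beta>\<^sub>2 y\<^sub>2)"
        by (simp only: \<chi> \<zeta> f zero add_0_left)
      finally show "f (0, scaleY \<beta>\<^sub>2 y\<^sub>2) =
          \<gamma>\<^sub>1\<^sub>1 * f (x\<^sub>1, y\<^sub>1) + \<gamma>\<^sub>1\<^sub>2 * f (x\<^sub>1, y\<^sub>2) + \<gamma>\<^sub>2\<^sub>1 * f (x\<^sub>2, y\<^sub>1) + \<gamma>\<^sub>2\<^sub>2 * f (x\<^sub>2, y\<^sub>2)"
        by (rule sym)
    qed
  qed
qed

end
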